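(* Let $\sigma>0$, $\epsilon\ge0$, and let $(u^m_j)$ be the solution to any one of the three schemes (MEC), (CN) or (LE) written out in the context, with additive noise right-hand side $\epsilon\tilde f^{\,m+\frac12}_j$, for a constant time mesh $\Delta t$ and constant space mesh $\Delta x$. Let $\tau^*_{\mathrm{dis}}$ be the maximal existence time of the discrete scheme. Then, given $T\in(0,\tau^*_{\mathrm{dis}})$ and any element $t_M=M\Delta t\le T$ of the time grid, we have for any $\alpha>0$ $$\mathbb E\big(M_{\mathrm{dis}}[u^M]\big)\le(1+\alpha)M_{\mathrm{dis}}[u^0]+\frac{3T(1+\alpha)}{4\ln(1+\alpha)}\,\epsilon^2\,\frac{L_c}{\Delta x}\,\frac{t_M}{\Delta t},\qquad\text{if }\Delta t\le\frac{T}{1+\alpha},$$ and $$\mathbb E\Big(\max_{0\le m\le M}M_{\mathrm{dis}}[u^m]\Big)\le\Big(1+\alpha+\frac{\alpha}{2T}\Big)M_{\mathrm{dis}}[u^0]+\frac{3T(1+\alpha)^2}{2\alpha}\,\epsilon^2\,\frac{L_c}{\Delta x}\,\frac{t_M}{\Delta t}.$$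
   Context: Setting: discretization of the 1D focusing stochastic nonlinear Schr\"odinger equation $iu_t+u_{xx}+|u|^{2\sigma}u=\epsilon f(u)$ with additive noise. Space grid: $x_0<\dots<x_N$ are $N+1$ equidistributed grid points in $[-L_c,L_c]$ with mesh size $\Delta x=x_{j+1}-x_j$; the number of grid points satisfies $N+1\le\frac{2L_c}{\Delta x}$. Time grid: $t_m=m\Delta t$, $\Delta t>0$. The complex-valued unknowns $u^m_j$ ($0\le j\le N$) approximate $u(t_m,x_j)$; the initial value $u^0_j=u_0(x_j)$ is deterministic, with $u_0\in H^1(\mathbb R)$. Discrete Neumann boundary conditions are imposed via the pseudo-point values $u^m_{-1}=u^m_0$, $u^m_{N+1}=u^m_N$. Noise: on a probability space, $\chi^{m+\frac12}_j$ ($m\ge0$, $0\le j\le N$) are independent real standard Gaussian random variables and $$\tilde f^{\,m+\frac12}_j=\frac{\sqrt3}{2}\frac{1}{\sqrt{\Delta t}\sqrt{\Delta x}}\,\chi^{m+\frac12}_j .$$ Notation: $u^{m+\frac12}_j=\frac12(u^m_j+u^{m+1}_j)$, $V^m_j=|u^m_j|^{2\sigma}$, $V^{m+\frac12}_j=|u^{m+\frac12}_j|^{2\sigma}$, $\mathcal D_2f_j=\frac{f_{j+1}-2f_j+f_{j-1}}{(\Delta x)^2}$. Schemes (for all $0\le j\le N$): (MEC), $m\ge0$: $$i\frac{u^{m+1}_j-u^m_j}{\Delta t}+\mathcal D_2u^{m+\frac12}_j+\frac1{\sigma+1}\frac{|u^{m+1}_j|^{2(\sigma+1)}-|u^m_j|^{2(\sigma+1)}}{|u^{m+1}_j|^2-|u^m_j|^2}\,u^{m+\frac12}_j=\epsilon\,\tilde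 f^{\,m+\frac12}_j,$$ the quotient being understood as $(\sigma+1)|u^m_j|^{2\sigma}$ when $|u^{m+1}_j|=|u^m_j|$. (CN), $m\ge0$: $$i\frac{u^{m+1}_j-u^m_j}{\Delta t}+\mathcal D_2u^{m+\frac12}_j+V^{m+\frac12}_ju^{m+\frac12}_j=\epsilon\,\tilde f^{\,m+\frac12}_j.$$ (LE), $m\ge1$: $$i\frac{u^{m+1}_j-u^m_j}{\Delta t}+\mathcal D_2u^{m+\frac12}_j+\frac12\big(3V^m_j-V^{m-1}_j\big)u^{m+\frac12}_j=\epsilon\,\tilde f^{\,m+\frac12}_j,$$ with the first step $u^1$ computed from $u^0$ by (CN) or (MEC). The solution is adapted: $u^m=(u^m_j)_j$ is measurable with respect to $\{\chi^{k+\frac12}_j:k<m,\ 0\le j\le N\}$. The condition $T<\tau^*_{\mathrm{dis}}$ means that the solution of the scheme is defined at all grid times $t_m\le T$. Discrete mass: $M_{\mathrm{dis}}[u^m]=\Delta x\sum_{j=0}^N|u^m_j|^2$. *)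

theory Defs
  imports "HOL-Probability.Probability"
begin

section \<open>The Sobolev space of initial data\<close>

definition test_function :: "(real \<Rightarrow> real) \<Rightarrow> bool" where
  "test_function \<phi> \<longleftrightarrow>
     (\<forall>k t. ((deriv ^^ k) \<phi>) differentiable (at t)) \<and> compact (closure {t. \<phi> t \<noteq> 0})"

definition square_integrable :: "(real \<Rightarrow> complex) \<Rightarrow> bool" where
  "square_integrable f \<longleftrightarrow>
     f \<in> borel_measurable lborel \<and> integrable lborel (\<lambda>t. (cmod (f t))\<^sup>2)"

definition weak_derivative :: "(real \<Rightarrow> complex) \<Rightarrow> (real \<Rightarrow> complex) \<Rightarrow> bool" where
  "weak_derivative f g \<longleftrightarrow>
     (\<forall>\<phi>. test_function \<phi> \<longrightarrow>
        (\<integral>t. f t * of_real (deriv \<phi> t) \<partial>lborel) = - (\<integral>t. g t * of_real (\<phi> t) \<partial>lborel))"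

definition in_H1 :: "(real \<Rightarrow> complex) \<Rightarrow> bool" where
  "in_H1 f \<longleftrightarrow> square_integrable f \<and> (\<exists>g. square_integrable g \<and> weak_derivative f g)"


section \<open>Grid and noise\<close>

text \<open>Space indices are integers, so that the pseudo-points \<open>-1\<close> and \<open>N + 1\<close> used by the
  Neumann conditions are available; the grid points proper are \<open>0, ..., N\<close>.\<close>

definition space_grid :: "real \<Rightarrow> nat \<Rightarrow> real \<Rightarrow> (int \<Rightarrow> real) \<Rightarrow> bool" where
  "space_grid Lc N dx x \<longleftrightarrow>
     0 < dx \<and>
     (\<forall>j\<in>{0..int N}. x j \<in> {-Lc..Lc}) \<and>
     (\<forall>j\<in>{0..<int N}. x (j + 1) - x j = dx) \<and>
     real (N + 1) \<le> 2 * Lc / dx"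

text \<open>\<open>\<xi> m j\<close> stands for the Gaussian variable with time index \<open>m + 1/2\<close>.\<close>

definition gaussian_noise :: "'a measure \<Rightarrow> nat \<Rightarrow> (nat \<Rightarrow> int \<Rightarrow> 'a \<Rightarrow> real) \<Rightarrow> bool" where
  "gaussian_noise P N \<xi> \<longleftrightarrow>
     prob_space P \<and>
     prob_space.indep_vars P (\<lambda>_. borel) (\<lambda>(m, j). \<xi> m j) (UNIV \<times> {0..int N}) \<and>
     (\<forall>m. \<forall>j\<in>{0..int N}. distributed P lborel (\<xi> m j) std_normal_density)"

definition scaled_noise :: "real \<Rightarrow> real \<Rightarrow> real \<Rightarrow> real" where
  "scaled_noise dt dx z = sqrt 3 / 2 * (1 / (sqrt dt * sqrt dx)) * z"

definition noise_history :: "'a measure \<Rightarrow> nat \<Rightarrow> (nat \<Rightarrow> int \<Rightarrow> 'a \<Rightarrow> real) \<Rightarrow> nat \<Rightarrow> 'a measure" where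
  "noise_history P N \<xi> m =
     sigma (space P) {\<xi> k j -` A \<inter> space P | k j A. k < m \<and> j \<in> {0..int N} \<and> A \<in> sets borel}"


section \<open>The schemes\<close>

text \<open>Here \<open>v m j\<close> is one realisation of the unknowns and \<open>r\<close> is the value of the
  right-hand side at the given point.\<close>

definition midpoint_value :: "(nat \<Rightarrow> int \<Rightarrow> complex) \<Rightarrow> nat \<Rightarrow> int \<Rightarrow> complex" where
  "midpoint_value v m j = (v m j + v (m + 1) j) / 2"

definition second_difference :: "real \<Rightarrow> (int \<Rightarrow> complex) \<Rightarrow> int \<Rightarrow> complex" where
  "second_difference dx f j = (f (j + 1) - 2 * f j + f (j - 1)) / of_real (dx\<^sup>2)"

definition potential :: "real \<Rightarrow> complex \<Rightarrow> real" where
  "potential \<sigma> z = cmod z powr (2 * \<sigma>)"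

definition mec_quotient :: "real \<Rightarrow> complex \<Rightarrow> complex \<Rightarrow> real" where
  "mec_quotient \<sigma> z w =
     (if cmod w = cmod z then (\<sigma> + 1) * cmod z powr (2 * \<sigma>)
      else (cmod w powr (2 * (\<sigma> + 1)) - cmod z powr (2 * (\<sigma> + 1))) / ((cmod w)\<^sup>2 - (cmod z)\<^sup>2))"

definition mec_equation ::
  "real \<Rightarrow> real \<Rightarrow> real \<Rightarrow> real \<Rightarrow> (nat \<Rightarrow> int \<Rightarrow> complex) \<Rightarrow> nat \<Rightarrow> int \<Rightarrow> bool" where
  "mec_equation \<sigma> dt dx r v m j \<longleftrightarrow>
     \<i> * ((v (m + 1) j - v m j) / of_real dt)
       + second_difference dx (midpoint_value v m) j
       + of_real (1 / (\<sigma> + 1) * mec_quotient \<sigma> (v m j) (v (m + 1) j)) * midpoint_value v m j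
     = of_real r"

definition cn_equation ::
  "real \<Rightarrow> real \<Rightarrow> real \<Rightarrow> real \<Rightarrow> (nat \<Rightarrow> int \<Rightarrow> complex) \<Rightarrow> nat \<Rightarrow> int \<Rightarrow> bool" where
  "cn_equation \<sigma> dt dx r v m j \<longleftrightarrow>
     \<i> * ((v (m + 1) j - v m j) / of_real dt)
       + second_difference dx (midpoint_value v m) j
       + of_real (potential \<sigma> (midpoint_value v m j)) * midpoint_value v m j
     = of_real r"

text \<open>Only used for \<open>m \<ge> 1\<close>, so the subtraction does not truncate.\<close>

definition le_equation ::
  "real \<Rightarrow> real \<Rightarrow> real \<Rightarrow> real \<Rightarrow> (nat \<Rightarrow> int \<Rightarrow> complex) \<Rightarrow> nat \<Rightarrow> int \<Rightarrow> bool" where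
  "le_equation \<sigma> dt dx r v m j \<longleftrightarrow>
     \<i> * ((v (m + 1) j - v m j) / of_real dt)
       + second_difference dx (midpoint_value v m) j
       + of_real (1 / 2 * (3 * potential \<sigma> (v m j) - potential \<sigma> (v (m - 1) j)))
           * midpoint_value v m j
     = of_real r"

text \<open>The two variants of LE differ in the scheme that produces the first step.\<close>

datatype scheme = MEC | CN | LE_from_CN | LE_from_MEC

fun scheme_equation ::
  "scheme \<Rightarrow> real \<Rightarrow> real \<Rightarrow> real \<Rightarrow> real \<Rightarrow> (nat \<Rightarrow> int \<Rightarrow> complex) \<Rightarrow> nat \<Rightarrow> int \<Rightarrow> bool" where
  "scheme_equation MEC \<sigma> dt dx r v m j = mec_equation \<sigma> dt dx r v m j"
| "scheme_equation CN \<sigma> dt dx r v m j = cn_equation \<sigma> dt dx r v m j"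
| "scheme_equation LE_from_CN \<sigma> dt dx r v m j =
     (if m = 0 then cn_equation \<sigma> dt dx r v m j else le_equation \<sigma> dt dx r v m j)"
| "scheme_equation LE_from_MEC \<sigma> dt dx r v m j =
     (if m = 0 then mec_equation \<sigma> dt dx r v m j else le_equation \<sigma> dt dx r v m j)"

text \<open>\<open>u\<close> is a solution of the scheme at all grid times \<open>t\<^sub>0, ..., t\<^sub>K\<close>; its values at later times
  are irrelevant.\<close>

definition solution_up_to ::
  "scheme \<Rightarrow> 'a measure \<Rightarrow> nat \<Rightarrow> (nat \<Rightarrow> int \<Rightarrow> 'a \<Rightarrow> real) \<Rightarrow> real \<Rightarrow> real \<Rightarrow> real \<Rightarrow> real \<Rightarrow>
   (int \<Rightarrow> complex) \<Rightarrow> (nat \<Rightarrow> int \<Rightarrow> 'a \<Rightarrow> complex) \<Rightarrow> nat \<Rightarrow> bool" where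
  "solution_up_to s P N \<xi> \<sigma> \<epsilon> dt dx v0 u K \<longleftrightarrow>
     (\<forall>j\<in>{0..int N}. \<forall>\<omega>\<in>space P. u 0 j \<omega> = v0 j) \<and>
     (\<forall>m\<le>K. \<forall>j\<in>{0..int N}. u m j \<in> borel_measurable (noise_history P N \<xi> m)) \<and>
     (\<forall>m\<le>K. \<forall>\<omega>\<in>space P. u m (-1) \<omega> = u m 0 \<omega> \<and> u m (int N + 1) \<omega> = u m (int N) \<omega>) \<and>
     (\<forall>m<K. \<forall>j\<in>{0..int N}. AE \<omega> in P.
        scheme_equation s \<sigma> dt dx (\<epsilon> * scaled_noise dt dx (\<xi> m j \<omega>)) (\<lambda>k i. u k i \<omega>) m j)"

text \<open>The first grid time at which the solution is no longer defined (\<open>\<infinity>\<close> if there is none).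
  Hence \<open>T < \<tau>\<close> means that the solution is defined at all grid times \<open>t\<^sub>m \<le> T\<close>.\<close>

definition existence_time ::
  "scheme \<Rightarrow> 'a measure \<Rightarrow> nat \<Rightarrow> (nat \<Rightarrow> int \<Rightarrow> 'a \<Rightarrow> real) \<Rightarrow> real \<Rightarrow> real \<Rightarrow> real \<Rightarrow> real \<Rightarrow>
   (int \<Rightarrow> complex) \<Rightarrow> (nat \<Rightarrow> int \<Rightarrow> 'a \<Rightarrow> complex) \<Rightarrow> ereal" where
  "existence_time s P N \<xi> \<sigma> \<epsilon> dt dx v0 u =
     Inf {ereal (real m * dt) | m. \<not> solution_up_to s P N \<xi> \<sigma> \<epsilon> dt dx v0 u m}"

definition discrete_mass :: "real \<Rightarrow> nat \<Rightarrow> (int \<Rightarrow> complex) \<Rightarrow> real" where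
  "discrete_mass dx N f = dx * (\<Sum>j\<in>{0..int N}. (cmod (f j))\<^sup>2)"

end

theory Submission
  imports Defs
begin

text \<open>
  Write \<open>M\<^sub>m\<close> for the discrete mass at time \<open>t\<^sub>m\<close>, \<open>r\<^sub>j\<close> for the right-hand side of the scheme in one
  step and \<open>g = dx \<Sum>\<^sub>j r\<^sub>j\<^sup>2\<close> for its energy. All the schemes are midpoint rules with a real
  potential in front of \<open>u\<^sup>m\<^sup>+\<^sup>1\<^sup>/\<^sup>2\<close>. Multiplying by the conjugate of the midpoint value, summing over
  the grid and taking imaginary parts therefore removes the nonlinearity, and with the Neumann
  conditions also the discrete Laplacian. What is left is the balance (\<open>mass_balance\<close>)
  \<open>M\<^sub>m\<^sub>+\<^sub>1 - M\<^sub>m = - dt dx \<Sum>\<^sub>j r\<^sub>j Im (u\<^sup>m\<^sub>j + u\<^sup>m\<^sup>+\<^sup>1\<^sub>j)\<close>,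
  and both bounds follow from it.

  For the maximum, the argument is pathwise up to the last step. Cauchy-Schwarz turns the balance into
  \<open>sqrt M\<^sub>m\<^sub>+\<^sub>1 \<le> sqrt M\<^sub>m + dt sqrt g\<close>, since the common factor \<open>sqrt M\<^sub>m + sqrt M\<^sub>m\<^sub>+\<^sub>1\<close> cancels.
  Summing these increments and squaring bounds every \<open>M\<^sub>m\<close>, \<open>m \<le> M\<close>, and hence their maximum, by
  one and the same combination of \<open>M\<^sub>0\<close> and the noise energies (\<open>mass_le_noise_energy\<close>), whose
  expectation is explicit (\<open>expected_max_mass\<close>). The same bound shows that all masses are
  integrable.

  For the mass at a single time, a better constant for small \<open>\<alpha>\<close> comes from the half of the balance
  that involves \<open>u\<^sup>m\<close>: it has mean zero, because \<open>u\<^sup>m\<close> is a function of the earlier noise and so is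
  independent of \<open>r\<close> (\<open>expectation_adapted_times_noise\<close>). The other half is absorbed by Young's
  inequality with a parameter \<open>\<delta>\<close>, which gives
  \<open>(1 - \<delta> dt) E M\<^sub>m\<^sub>+\<^sub>1 \<le> E M\<^sub>m + dt / (4 \<delta>) E g\<close> (\<open>expected_mass_step\<close>). A discrete Gronwall argument
  produces the factor \<open>exp (2 \<delta> t\<^sub>M)\<close> as long as \<open>\<delta> dt \<le> 1/2\<close>. The choice \<open>\<delta> = ln (1 + \<alpha>) / (2 T)\<close> makes
  this factor at most \<open>1 + \<alpha>\<close>, and the condition on \<open>\<delta> dt\<close> follows from \<open>dt \<le> T / (1 + \<alpha>)\<close>.
\<close>

section \<open>The discrete mass balance\<close>

text \<open>That the potential is real is the only property of the nonlinearity that matters for the mass,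
  so the rest of the argument treats all the schemes at once.\<close>

lemma scheme_equation_real_potential:
  assumes "scheme_equation s \<sigma> dt dx r v m j"
  obtains V :: real where
    "\<i> * ((v (m + 1) j - v m j) / of_real dt) + second_difference dx (midpoint_value v m) j
       + of_real V * midpoint_value v m j = of_real r"
  using assms
  by (cases s; cases "m = 0"; simp only: scheme_equation.simps simp_thms if_True if_False
      mec_equation_def cn_equation_def le_equation_def; blast)

lemma sum_int_telescope:
  fixes g :: "int \<Rightarrow> 'b::ab_group_add"
  shows "(\<Sum>j\<in>{0..int n}. g (j + 1) - g j) = g (int n + 1) - g 0"
proof (induction n)
  case (Suc n)
  have "{0..int (Suc n)} = insert (int n + 1) {0..int n}" by auto
  then show ?case using Suc by (simp add: add.commute)
qed simp

text \<open>Summation by parts: up to the factor \<open>1 / dx\<^sup>2\<close> each summand is the increment of the flux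
  \<open>Im (f\<^sub>j cnj f\<^sub>j\<^sub>-\<^sub>1)\<close>. The Neumann conditions make the flux through both ends the imaginary part of
  some \<open>|f|\<^sup>2\<close>, that is, zero.\<close>

lemma sum_Im_second_difference_Neumann:
  assumes "f (-1) = f 0" and "f (int N + 1) = f (int N)"
  shows "(\<Sum>j\<in>{0..int N}. Im (second_difference dx f j * cnj (f j))) = 0"
proof -
  define g where "g j = Im (f j * cnj (f (j - 1)))" for j
  have "Im (second_difference dx f j * cnj (f j)) = (g (j + 1) - g j) / dx\<^sup>2" for j
  proof -
    have "second_difference dx f j * cnj (f j)
        = ((f (j + 1) - 2 * f j + f (j - 1)) * cnj (f j)) / of_real (dx\<^sup>2)"
      by (simp add: second_difference_def)
    then have "Im (second_difference dx f j * cnj (f j))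
        = Im ((f (j + 1) - 2 * f j + f (j - 1)) * cnj (f j)) / dx\<^sup>2"
      by (simp only: Im_divide_of_real)
    also have "Im ((f (j + 1) - 2 * f j + f (j - 1)) * cnj (f j)) = g (j + 1) - g j"
      by (simp add: g_def algebra_simps)
    finally show ?thesis .
  qed
  then have "(\<Sum>j\<in>{0..int N}. Im (second_difference dx f j * cnj (f j)))
      = (\<Sum>j\<in>{0..int N}. g (j + 1) - g j) / dx\<^sup>2"
    by (simp add: sum_divide_distrib)
  also have "(\<Sum>j\<in>{0..int N}. g (j + 1) - g j) = 0"
    unfolding sum_int_telescope by (simp add: g_def assms)
  finally show ?thesis by simp
qed

text \<open>The scheme tested with the conjugate of the midpoint value. The time difference contributes
  \<open>Im (\<i> (b - a) cnj (a + b)) = |b|\<^sup>2 - |a|\<^sup>2\<close>, the exact increment of the mass density.\<close>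

lemma mass_balance:
  assumes "dt > 0"
    and Neumann: "\<And>k. k \<in> {m, m + 1} \<Longrightarrow> v k (-1) = v k 0 \<and> v k (int N + 1) = v k (int N)"
    and scheme: "\<And>j. j \<in> {0..int N} \<Longrightarrow> scheme_equation s \<sigma> dt dx (r j) v m j"
  shows "discrete_mass dx N (v (m + 1)) - discrete_mass dx N (v m)
    = - (dt * dx * (\<Sum>j\<in>{0..int N}. r j * Im (v m j + v (m + 1) j)))"
proof -
  define w where "w = midpoint_value v m"
  have w: "w j = (v m j + v (m + 1) j) / 2" for j
    by (simp add: w_def midpoint_value_def)
  \<comment> \<open>The discrete Laplacian is kept here, as its contribution vanishes only after summation.\<close>
  have point: "((cmod (v (m + 1) j))\<^sup>2 - (cmod (v m j))\<^sup>2)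
      = 2 * dt * (- Im (second_difference dx w j * cnj (w j)) - r j * Im (v m j + v (m + 1) j) / 2)"
    if j: "j \<in> {0..int N}" for j
  proof -
    let ?b = "v (m + 1) j" and ?a = "v m j"
    obtain V :: real where eq: "\<i> * ((?b - ?a) / of_real dt) + second_difference dx w j
        + of_real V * w j = of_real (r j)"
      using scheme_equation_real_potential[OF scheme[OF j]] unfolding w_def by blast
    have "Im (\<i> * ((?b - ?a) / of_real dt) * cnj (w j)) + Im (second_difference dx w j * cnj (w j))
        + Im (of_real V * w j * cnj (w j)) = Im (of_real (r j) * cnj (w j))"
      unfolding eq[symmetric] by (simp add: algebra_simps)
    moreover have "Im (\<i> * ((?b - ?a) / of_real dt) * cnj (w j)) = ((cmod ?b)\<^sup>2 - (cmod ?a)\<^sup>2) / (2 * dt)"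
      using \<open>dt > 0\<close> unfolding w cmod_power2
      by (simp add: field_simps power2_eq_square Re_divide_of_real Im_divide_of_real)
    moreover have "Im (of_real V * w j * cnj (w j)) = 0"
      by (simp add: algebra_simps)
    moreover have "Im (of_real (r j) * cnj (w j)) = - (r j * Im (?a + ?b) / 2)"
      by (simp add: w) (simp add: algebra_simps)
    ultimately have "((cmod ?b)\<^sup>2 - (cmod ?a)\<^sup>2) / (2 * dt)
        = - Im (second_difference dx w j * cnj (w j)) - r j * Im (?a + ?b) / 2"
      by linarith
    then have "2 * dt * (((cmod ?b)\<^sup>2 - (cmod ?a)\<^sup>2) / (2 * dt))
        = 2 * dt * (- Im (second_difference dx w j * cnj (w j)) - r j * Im (?a + ?b) / 2)"
      by (rule arg_cong)
    then show ?thesis using \<open>dt > 0\<close> by simp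
  qed
  have flux: "(\<Sum>j\<in>{0..int N}. Im (second_difference dx w j * cnj (w j))) = 0"
    by (rule sum_Im_second_difference_Neumann) (use Neumann in \<open>auto simp: w\<close>)
  have "(\<Sum>j\<in>{0..int N}. (cmod (v (m + 1) j))\<^sup>2 - (cmod (v m j))\<^sup>2)
      = (\<Sum>j\<in>{0..int N}. 2 * dt * (- Im (second_difference dx w j * cnj (w j))
          - r j * Im (v m j + v (m + 1) j) / 2))"
    by (rule sum.cong[OF refl point])
  also have "\<dots> = - (dt * (\<Sum>j\<in>{0..int N}. r j * Im (v m j + v (m + 1) j)))"
    unfolding sum_distrib_left[symmetric] sum_subtractf sum_negf sum_divide_distrib[symmetric] flux
    by simp
  finally show ?thesis
    unfolding discrete_mass_def right_diff_distrib[symmetric] sum_subtractf[symmetric] by simp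
qed


section \<open>Pathwise growth of the mass\<close>

lemma sqrt_discrete_mass: "sqrt (discrete_mass dx N f) = sqrt dx * L2_set (\<lambda>j. cmod (f j)) {0..int N}"
  by (simp add: discrete_mass_def L2_set_def real_sqrt_mult)

lemma discrete_mass_nonneg: "0 \<le> dx \<Longrightarrow> 0 \<le> discrete_mass dx N f"
  by (simp add: discrete_mass_def sum_nonneg)

text \<open>Applied to the right-hand side of the scheme, the discrete mass is the energy of the noise; this
  is how noise energies are written below.\<close>

lemma discrete_mass_of_real:
  "discrete_mass dx N (\<lambda>j. of_real (r j)) = dx * (\<Sum>j\<in>{0..int N}. (r j)\<^sup>2)"
  by (simp add: discrete_mass_def)

lemma discrete_mass_Cauchy_Schwarz:
  assumes "0 \<le> dx"
  shows "dx * (\<Sum>j\<in>{0..int N}. cmod (f j) * cmod (g j))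
    \<le> sqrt (discrete_mass dx N f) * sqrt (discrete_mass dx N g)"
proof -
  have "(\<Sum>j\<in>{0..int N}. cmod (f j) * cmod (g j))
      \<le> L2_set (\<lambda>j. cmod (f j)) {0..int N} * L2_set (\<lambda>j. cmod (g j)) {0..int N}"
    using L2_set_mult_ineq[of "\<lambda>j. cmod (f j)" "\<lambda>j. cmod (g j)"] by simp
  then have "dx * (\<Sum>j\<in>{0..int N}. cmod (f j) * cmod (g j))
      \<le> dx * (L2_set (\<lambda>j. cmod (f j)) {0..int N} * L2_set (\<lambda>j. cmod (g j)) {0..int N})"
    using assms by (rule mult_left_mono)
  also have "\<dots> = (sqrt dx * sqrt dx) * (L2_set (\<lambda>j. cmod (f j)) {0..int N} * L2_set (\<lambda>j. cmod (g j)) {0..int N})"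
    using assms by simp
  finally show ?thesis
    unfolding sqrt_discrete_mass by (simp only: ac_simps)
qed

text \<open>With \<open>A\<close>, \<open>B\<close>, \<open>R\<close> the norms of old value, new value and right-hand side, Cauchy-Schwarz in the
  balance reads \<open>B\<^sup>2 - A\<^sup>2 \<le> dt R (A + B)\<close>, and \<open>A + B\<close> can be divided out. An estimate for the
  squares would have to absorb a multiple of \<open>dt B\<^sup>2\<close> on the left, which forces \<open>dt\<close> to be small.\<close>

lemma sqrt_mass_step:
  assumes "dt > 0" "dx > 0"
    and balance: "discrete_mass dx N b - discrete_mass dx N a
      = - (dt * dx * (\<Sum>j\<in>{0..int N}. r j * Im (a j + b j)))"
  shows "sqrt (discrete_mass dx N b)
    \<le> sqrt (discrete_mass dx N a) + dt * sqrt (discrete_mass dx N (\<lambda>j. of_real (r j)))"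
proof -
  define A B R where "A = sqrt (discrete_mass dx N a)" and "B = sqrt (discrete_mass dx N b)"
    and "R = sqrt (discrete_mass dx N (\<lambda>j. of_real (r j)))"
  have nonneg: "0 \<le> A" "0 \<le> B" "0 \<le> R"
    using \<open>dx > 0\<close> by (simp_all add: A_def B_def R_def discrete_mass_nonneg)
  have pointwise: "- (r j * Im (a j + b j)) \<le> cmod (of_real (r j)) * cmod (a j) + cmod (of_real (r j)) * cmod (b j)" for j
  proof -
    have "- (r j * Im (a j + b j)) \<le> \<bar>r j\<bar> * \<bar>Im (a j + b j)\<bar>"
      by (metis abs_ge_minus_self abs_mult)
    also have "\<dots> \<le> \<bar>r j\<bar> * (cmod (a j) + cmod (b j))"
      by (intro mult_left_mono order_trans[OF abs_Im_le_cmod norm_triangle_ineq]) simp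
    finally show ?thesis by (simp add: distrib_left)
  qed
  have "dx * (\<Sum>j\<in>{0..int N}. - (r j * Im (a j + b j)))
      \<le> dx * (\<Sum>j\<in>{0..int N}. cmod (of_real (r j)) * cmod (a j) + cmod (of_real (r j)) * cmod (b j))"
    using \<open>dx > 0\<close> by (intro mult_left_mono sum_mono pointwise) simp
  also have "\<dots> \<le> R * A + R * B"
    unfolding sum.distrib distrib_left A_def B_def R_def
    using \<open>dx > 0\<close> by (intro add_mono discrete_mass_Cauchy_Schwarz) auto
  finally have "dt * (dx * (\<Sum>j\<in>{0..int N}. - (r j * Im (a j + b j)))) \<le> dt * (R * A + R * B)"
    using \<open>dt > 0\<close> by simp
  moreover have "B\<^sup>2 - A\<^sup>2 = dt * (dx * (\<Sum>j\<in>{0..int N}. - (r j * Im (a j + b j))))"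
    using \<open>dx > 0\<close> balance by (simp add: A_def B_def discrete_mass_nonneg sum_negf mult.assoc)
  ultimately have *: "(B - A) * (B + A) \<le> (dt * R) * (B + A)"
    by (simp add: power2_eq_square algebra_simps)
  have "B \<le> A + dt * R"
  proof (cases "B + A = 0")
    case True
    then show ?thesis using nonneg \<open>dt > 0\<close> by (simp add: add_nonneg_eq_0_iff)
  next
    case False
    then have "0 < B + A" using nonneg by linarith
    with * have "B - A \<le> dt * R" by (rule mult_right_le_imp_le)
    then show ?thesis by simp
  qed
  then show ?thesis by (simp add: A_def B_def R_def)
qed

lemma power2_add_weighted:
  fixes a b :: real
  assumes "\<alpha> > 0"
  shows "(a + b)\<^sup>2 \<le> (1 + \<alpha>) * a\<^sup>2 + (1 + 1 / \<alpha>) * b\<^sup>2"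
proof -
  have "(1 + \<alpha>) * a\<^sup>2 + (1 + 1 / \<alpha>) * b\<^sup>2 - (a + b)\<^sup>2 = (\<alpha> * a - b)\<^sup>2 / \<alpha>"
    using assms by (simp add: field_simps power2_eq_square)
  moreover have "0 \<le> (\<alpha> * a - b)\<^sup>2 / \<alpha>" using assms by simp
  ultimately show ?thesis by linarith
qed

lemma sum_power2_le_card:
  fixes c :: "nat \<Rightarrow> real"
  shows "(\<Sum>k<M. c k)\<^sup>2 \<le> real M * (\<Sum>k<M. (c k)\<^sup>2)"
  using sum_squared_le_sum_of_squares[of c "{..<M}"] by (simp add: mult.commute)

lemma square_of_summed_increments:
  fixes a c :: "nat \<Rightarrow> real"
  assumes "\<alpha> > 0" and a: "\<And>k. 0 \<le> a k" and c: "\<And>k. 0 \<le> c k"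
    and step: "\<And>k. k < M \<Longrightarrow> a (k + 1) \<le> a k + c k" and "m \<le> M"
  shows "(a m)\<^sup>2 \<le> (1 + \<alpha>) * (a 0)\<^sup>2 + (1 + 1 / \<alpha>) * (real M * (\<Sum>k<M. (c k)\<^sup>2))"
proof -
  have "m \<le> M \<Longrightarrow> a m \<le> a 0 + (\<Sum>k<m. c k)"
  proof (induction m)
    case (Suc m)
    then show ?case using step[of m] by simp
  qed simp
  also have "(\<Sum>k<m. c k) \<le> (\<Sum>k<M. c k)"
    using \<open>m \<le> M\<close> c by (intro sum_mono2) auto
  finally have "(a m)\<^sup>2 \<le> (a 0 + (\<Sum>k<M. c k))\<^sup>2"
    using \<open>m \<le> M\<close> a by (intro power_mono) auto
  also have "\<dots> \<le> (1 + \<alpha>) * (a 0)\<^sup>2 + (1 + 1 / \<alpha>) * (\<Sum>k<M. c k)\<^sup>2"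
    using \<open>\<alpha> > 0\<close> by (rule power2_add_weighted)
  also have "\<dots> \<le> (1 + \<alpha>) * (a 0)\<^sup>2 + (1 + 1 / \<alpha>) * (real M * (\<Sum>k<M. (c k)\<^sup>2))"
    using \<open>\<alpha> > 0\<close> by (intro add_left_mono mult_left_mono sum_power2_le_card) auto
  finally show ?thesis .
qed

text \<open>The right-hand side is the same for every \<open>m \<le> M\<close>, so that it also bounds the maximum over
  these times.\<close>

lemma mass_le_noise_energy:
  assumes "\<alpha> > 0" "dt > 0" "dx > 0" "m \<le> M"
    and balance: "\<And>k. k < M \<Longrightarrow> discrete_mass dx N (v (k + 1)) - discrete_mass dx N (v k)
      = - (dt * dx * (\<Sum>j\<in>{0..int N}. r k j * Im (v k j + v (k + 1) j)))"
  shows "discrete_mass dx N (v m) \<le> (1 + \<alpha>) * discrete_mass dx N (v 0)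
    + (1 + 1 / \<alpha>) * (real M * (\<Sum>k<M. dt\<^sup>2 * discrete_mass dx N (\<lambda>j. of_real (r k j))))"
proof -
  let ?a = "\<lambda>k. sqrt (discrete_mass dx N (v k))"
  let ?c = "\<lambda>k. dt * sqrt (discrete_mass dx N (\<lambda>j. of_real (r k j)))"
  have "(?a m)\<^sup>2 \<le> (1 + \<alpha>) * (?a 0)\<^sup>2 + (1 + 1 / \<alpha>) * (real M * (\<Sum>k<M. (?c k)\<^sup>2))"
  proof (rule square_of_summed_increments)
    show "?a (k + 1) \<le> ?a k + ?c k" if "k < M" for k
      using \<open>dt > 0\<close> \<open>dx > 0\<close> balance[OF that] by (rule sqrt_mass_step)
  qed (use assms(1-4) in \<open>simp_all add: discrete_mass_nonneg\<close>)
  then show ?thesis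
    using \<open>dx > 0\<close> by (simp add: discrete_mass_nonneg power_mult_distrib)
qed

lemma product_le_weighted_squares:
  fixes x y :: real
  assumes "\<delta> > 0"
  shows "- (y * x) \<le> \<delta> * x\<^sup>2 + y\<^sup>2 / (4 * \<delta>)"
proof -
  have "0 \<le> (2 * \<delta> * x + y)\<^sup>2 / (4 * \<delta>)"
    using assms by simp
  also have "\<dots> = \<delta> * x\<^sup>2 + y\<^sup>2 / (4 * \<delta>) + y * x"
    using assms by (simp add: power2_sum power_mult_distrib add_divide_distrib power2_eq_square[of \<delta>])
  finally show ?thesis by linarith
qed

text \<open>Here only the part of the balance with the new value \<open>b\<close> is estimated, by Young's inequality with
  the parameter \<open>\<delta>\<close>. The part with the old value \<open>a\<close> is kept because it has mean zero when \<open>a\<close> is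
  independent of the noise.\<close>

lemma mass_step_implicit:
  assumes "dt > 0" "dx > 0" "\<delta> > 0"
    and balance: "discrete_mass dx N b - discrete_mass dx N a
      = - (dt * dx * (\<Sum>j\<in>{0..int N}. r j * Im (a j + b j)))"
  shows "(1 - \<delta> * dt) * discrete_mass dx N b \<le> discrete_mass dx N a
    - dt * dx * (\<Sum>j\<in>{0..int N}. r j * Im (a j))
    + dt / (4 * \<delta>) * discrete_mass dx N (\<lambda>j. of_real (r j))"
proof -
  have pointwise: "- (r j * Im (b j)) \<le> \<delta> * (cmod (b j))\<^sup>2 + (r j)\<^sup>2 / (4 * \<delta>)" for j
  proof -
    have "- (r j * Im (b j)) \<le> \<delta> * (Im (b j))\<^sup>2 + (r j)\<^sup>2 / (4 * \<delta>)"
      using \<open>\<delta> > 0\<close> by (rule product_le_weighted_squares)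
    moreover have "\<delta> * (Im (b j))\<^sup>2 \<le> \<delta> * (cmod (b j))\<^sup>2"
      using \<open>\<delta> > 0\<close> by (simp add: cmod_power2)
    ultimately show ?thesis by linarith
  qed
  have "dt * dx * (\<Sum>j\<in>{0..int N}. - (r j * Im (b j)))
      \<le> dt * dx * (\<Sum>j\<in>{0..int N}. \<delta> * (cmod (b j))\<^sup>2 + (r j)\<^sup>2 / (4 * \<delta>))"
    using \<open>dt > 0\<close> \<open>dx > 0\<close> by (intro mult_left_mono sum_mono pointwise) simp
  also have "\<dots> = \<delta> * dt * discrete_mass dx N b
      + dt / (4 * \<delta>) * discrete_mass dx N (\<lambda>j. of_real (r j))"
    unfolding discrete_mass_of_real
    unfolding discrete_mass_def sum.distrib sum_distrib_left[symmetric] sum_divide_distrib[symmetric]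
    by (simp add: distrib_left)
  finally have "- (dt * dx * (\<Sum>j\<in>{0..int N}. r j * Im (b j))) \<le> \<dots>"
    by (simp add: sum_negf)
  moreover have "dt * dx * (\<Sum>j\<in>{0..int N}. r j * Im (a j + b j))
      = dt * dx * (\<Sum>j\<in>{0..int N}. r j * Im (a j)) + dt * dx * (\<Sum>j\<in>{0..int N}. r j * Im (b j))"
    by (simp add: sum.distrib distrib_left)
  ultimately show ?thesis
    using balance unfolding left_diff_distrib by simp
qed


section \<open>The noise\<close>

lemma gaussian_noiseD:
  assumes "gaussian_noise P N \<xi>"
  shows "prob_space P"
    and "prob_space.indep_vars P (\<lambda>_. borel) (\<lambda>(m, j). \<xi> m j) (UNIV \<times> {0..int N})"
    and "j \<in> {0..int N} \<Longrightarrow> distributed P lborel (\<xi> m j) std_normal_density"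
    and "j \<in> {0..int N} \<Longrightarrow> \<xi> m j \<in> borel_measurable P"
proof -
  show "j \<in> {0..int N} \<Longrightarrow> distributed P lborel (\<xi> m j) std_normal_density"
    using assms by (auto simp: gaussian_noise_def)
  then show "j \<in> {0..int N} \<Longrightarrow> \<xi> m j \<in> borel_measurable P"
    using distributed_measurable by fastforce
qed (use assms in \<open>auto simp: gaussian_noise_def\<close>)

lemma subalgebra_noise_history:
  assumes "gaussian_noise P N \<xi>"
  shows "subalgebra P (noise_history P N \<xi> m)"
  unfolding subalgebra_def noise_history_def
  using gaussian_noiseD(4)[OF assms]
  by (auto intro!: sets.sigma_sets_subset simp: sets_measure_of_conv space_measure_of_conv)

lemma (in prob_space) std_normal_moments:
  assumes "distributed M lborel X std_normal_density"
  shows "integrable M (\<lambda>\<omega>. X \<omega>)" "expectation X = 0"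
    and "integrable M (\<lambda>\<omega>. (X \<omega>)\<^sup>2)" "expectation (\<lambda>\<omega>. (X \<omega>)\<^sup>2) = 1"
proof -
  show "integrable M (\<lambda>\<omega>. X \<omega>)"
    using distributed_integrable[OF assms, of "\<lambda>x. x"] integrable_std_normal_moment[of 1] by simp
  show "expectation X = 0"
    using distributed_integral[OF assms, of "\<lambda>x. x"] integral_std_normal_moment_odd[of 0] by simp
  show "integrable M (\<lambda>\<omega>. (X \<omega>)\<^sup>2)"
    using distributed_integrable[OF assms, of "\<lambda>x. x\<^sup>2"] integrable_std_normal_moment[of 2] by simp
  show "expectation (\<lambda>\<omega>. (X \<omega>)\<^sup>2) = 1"
    using distributed_integral[OF assms, of "\<lambda>x. x\<^sup>2"] integral_std_normal_moment_even[of 1] by simp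
qed

text \<open>The family of all noise variables is split into those before time \<open>m\<close> and the single variable at
  \<open>(m, j)\<close>; as vectors indexed by these disjoint sets, past and present are independent. The events
  of the noise history are generated by coordinates of the past vector, so every adapted variable
  inherits the independence.\<close>

lemma adapted_indep_current_noise:
  assumes noise: "gaussian_noise P N \<xi>"
    and X: "X \<in> borel_measurable (noise_history P N \<xi> m)" and j: "j \<in> {0..int N}"
  shows "prob_space.indep_var P borel X borel (\<xi> m j)"
proof -
  interpret prob_space P using gaussian_noiseD(1)[OF noise] .
  let ?A = "{..<m} \<times> {0..int N}" and ?B = "{(m, j)}"
  let ?past = "\<lambda>\<omega>. restrict (\<lambda>i. (case i of (m, j) \<Rightarrow> \<xi> m j) \<omega>) ?A"
  let ?now = "\<lambda>\<omega>. restrict (\<lambda>i. (case i of (m, j) \<Rightarrow> \<xi> m j) \<omega>) ?B"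
  let ?PA = "PiM ?A (\<lambda>_. borel :: real measure)" and ?PB = "PiM ?B (\<lambda>_. borel :: real measure)"
  let ?gen = "{\<xi> k j -` A \<inter> space P | k j A. k < m \<and> j \<in> {0..int N} \<and> A \<in> sets borel}"
  have ind: "indep_var ?PA ?past ?PB ?now"
    using gaussian_noiseD(2)[OF noise] by (rule indep_var_restrict) (use j in auto)
  have "indep_set (sigma_sets (space P) {?past -` A \<inter> space P | A. A \<in> sets ?PA})
      (sigma_sets (space P) {?now -` A \<inter> space P | A. A \<in> sets ?PB})"
    using ind unfolding indep_var_eq by blast
  moreover have "sigma_sets (space P) {X -` A \<inter> space P | A. A \<in> sets borel}
      \<subseteq> sigma_sets (space P) {?past -` A \<inter> space P | A. A \<in> sets ?PA}"
  proof -
    have gen_Pow: "?gen \<subseteq> Pow (space P)" by auto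
    have hist_sets: "sets (noise_history P N \<xi> m) = sigma_sets (space P) ?gen"
      and hist_space: "space (noise_history P N \<xi> m) = space P"
      using gen_Pow by (simp_all add: noise_history_def)
    \<comment> \<open>Each generator is the preimage of a cylinder set under the past vector.\<close>
    have "?gen \<subseteq> {?past -` A \<inter> space P | A. A \<in> sets ?PA}"
    proof (safe, goal_cases)
      case (1 _ k i A)
      have ki: "(k, i) \<in> ?A" using 1 by auto
      have "(\<lambda>h. h (k, i)) -` A \<inter> space ?PA \<in> sets ?PA"
        using measurable_component_singleton[OF ki] \<open>A \<in> sets borel\<close> by (rule measurable_sets)
      moreover have "\<xi> k i -` A \<inter> space P = ?past -` ((\<lambda>h. h (k, i)) -` A \<inter> space ?PA) \<inter> space P"
        using ki by (auto simp: space_PiM PiE_def)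
      ultimately show ?case by blast
    qed
    then have "sigma_sets (space P) ?gen \<subseteq> sigma_sets (space P) {?past -` A \<inter> space P | A. A \<in> sets ?PA}"
      by (rule sigma_sets_subseteq)
    moreover have "{X -` A \<inter> space P | A. A \<in> sets borel} \<subseteq> sigma_sets (space P) ?gen"
      using measurable_sets[OF X] by (auto simp: hist_sets hist_space)
    ultimately show ?thesis
      by (intro sigma_sets_mono) blast
  qed
  moreover have "sigma_sets (space P) {\<xi> m j -` A \<inter> space P | A. A \<in> sets borel}
      \<subseteq> sigma_sets (space P) {?now -` A \<inter> space P | A. A \<in> sets ?PB}"
  proof (rule sigma_sets_subseteq, safe, goal_cases)
    case (1 _ A)
    have mj: "(m, j) \<in> ?B" by simp
    have "(\<lambda>h. h (m, j)) -` A \<inter> space ?PB \<in> sets ?PB"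
      using measurable_component_singleton[OF mj] \<open>A \<in> sets borel\<close> by (rule measurable_sets)
    moreover have "\<xi> m j -` A \<inter> space P = ?now -` ((\<lambda>h. h (m, j)) -` A \<inter> space ?PB) \<inter> space P"
      by (auto simp: space_PiM PiE_def)
    ultimately show ?case by blast
  qed
  ultimately have "indep_set (sigma_sets (space P) {X -` A \<inter> space P | A. A \<in> sets borel})
      (sigma_sets (space P) {\<xi> m j -` A \<inter> space P | A. A \<in> sets borel})"
    unfolding indep_sets2_eq by blast
  moreover have "X \<in> borel_measurable P"
    using measurable_from_subalg[OF subalgebra_noise_history[OF noise] X] .
  ultimately show ?thesis
    using gaussian_noiseD(4)[OF noise j] unfolding indep_var_eq by blast
qed

lemma expectation_adapted_times_noise:
  fixes X :: "'a \<Rightarrow> real"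
  assumes noise: "gaussian_noise P N \<xi>"
    and X: "X \<in> borel_measurable (noise_history P N \<xi> m)" and j: "j \<in> {0..int N}"
    and int: "integrable P X"
  shows "integrable P (\<lambda>\<omega>. X \<omega> * \<xi> m j \<omega>)" and "(\<integral>\<omega>. X \<omega> * \<xi> m j \<omega> \<partial>P) = 0"
proof -
  interpret prob_space P using gaussian_noiseD(1)[OF noise] .
  note ind = adapted_indep_current_noise[OF noise X j]
  note mom = std_normal_moments[OF gaussian_noiseD(3)[OF noise j], of m]
  show "integrable P (\<lambda>\<omega>. X \<omega> * \<xi> m j \<omega>)"
    using indep_var_integrable[OF ind int mom(1)] .
  show "(\<integral>\<omega>. X \<omega> * \<xi> m j \<omega> \<partial>P) = 0"
    using indep_var_lebesgue_integral[OF ind int mom(1)] mom(2) by simp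
qed

text \<open>The scaling of the noise gives each \<open>r\<^sub>j\<close> the variance \<open>3 \<epsilon>\<^sup>2 / (4 dt dx)\<close>; the factor \<open>dx\<close> cancels
  in the energy.\<close>

lemma expectation_noise_energy:
  fixes \<epsilon> :: real and m :: nat
  assumes noise: "gaussian_noise P N \<xi>" and "dt > 0" "dx > 0"
  defines "g \<equiv> \<lambda>\<omega>. discrete_mass dx N (\<lambda>j. of_real (\<epsilon> * scaled_noise dt dx (\<xi> m j \<omega>)))"
  shows "integrable P g" and "(\<integral>\<omega>. g \<omega> \<partial>P) = 3 / 4 * \<epsilon>\<^sup>2 * real (N + 1) / dt"
proof -
  interpret prob_space P using gaussian_noiseD(1)[OF noise] .
  note mom = std_normal_moments[OF gaussian_noiseD(3)[OF noise]]
  have g: "g = (\<lambda>\<omega>. (\<Sum>j\<in>{0..int N}. 3 / 4 * \<epsilon>\<^sup>2 / dt * (\<xi> m j \<omega>)\<^sup>2))"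
    using \<open>dt > 0\<close> \<open>dx > 0\<close> unfolding g_def discrete_mass_of_real
    by (simp add: scaled_noise_def power_mult_distrib power_divide
        sum_distrib_left fun_eq_iff ac_simps)
  show "integrable P g"
    unfolding g using mom by (intro Bochner_Integration.integrable_sum) auto
  show "(\<integral>\<omega>. g \<omega> \<partial>P) = 3 / 4 * \<epsilon>\<^sup>2 * real (N + 1) / dt"
    unfolding g using mom by (subst Bochner_Integration.integral_sum) auto
qed


section \<open>A discrete Gronwall bound\<close>

text \<open>Multiplying the step by \<open>(1 - y)\<^sup>k\<close> telescopes the inequality. The factor \<open>(1 - y)\<^sup>-\<^sup>M\<close> that
  remains is at most \<open>exp (2 y M)\<close>, because \<open>(1 + 2 y) (1 - y) = 1 + y (1 - 2 y) \<ge> 1\<close> for \<open>y \<le> 1/2\<close>.\<close>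

lemma implicit_Gronwall:
  fixes e :: "nat \<Rightarrow> real"
  assumes y: "0 \<le> y" "y \<le> 1 / 2" and "0 \<le> c" "0 \<le> e 0"
    and step: "\<And>k. k < M \<Longrightarrow> (1 - y) * e (k + 1) \<le> e k + c"
  shows "e M \<le> exp (2 * y * real M) * (e 0 + real M * c)"
proof -
  have "m \<le> M \<Longrightarrow> (1 - y) ^ m * e m \<le> e 0 + real m * c" for m
  proof (induction m)
    case (Suc m)
    have "(1 - y) ^ Suc m * e (Suc m) = (1 - y) ^ m * ((1 - y) * e (m + 1))" by simp
    also have "\<dots> \<le> (1 - y) ^ m * (e m + c)"
      using y Suc.prems by (intro mult_left_mono step) auto
    also have "\<dots> \<le> (1 - y) ^ m * e m + c"
      using y \<open>0 \<le> c\<close> by (simp add: distrib_left mult_left_le_one_le power_le_one)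
    finally show ?case using Suc by (simp add: algebra_simps)
  qed simp
  from this[of M] have "exp (2 * y * real M) * ((1 - y) ^ M * e M) \<le> exp (2 * y * real M) * (e 0 + real M * c)"
    by simp
  moreover have "e M \<le> exp (2 * y * real M) * ((1 - y) ^ M * e M)" if "0 \<le> e M"
  proof -
    have "1 \<le> (1 + 2 * y) * (1 - y)"
      using y mult_left_mono[of y "1/2" y] by (simp add: algebra_simps)
    also have "\<dots> \<le> exp (2 * y) * (1 - y)"
      using y by (intro mult_right_mono exp_ge_add_one_self) auto
    finally have "1 \<le> (exp (2 * y) * (1 - y)) ^ M" by (rule one_le_power)
    also have "\<dots> = exp (2 * y * real M) * (1 - y) ^ M"
      by (simp add: power_mult_distrib exp_of_nat_mult mult.commute)
    finally have "1 * e M \<le> exp (2 * y * real M) * (1 - y) ^ M * e M"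
      using that by (rule mult_right_mono)
    then show ?thesis by (simp add: mult.assoc)
  qed
  moreover have "0 \<le> exp (2 * y * real M) * (e 0 + real M * c)"
    using \<open>0 \<le> c\<close> \<open>0 \<le> e 0\<close> by simp
  ultimately show ?thesis by linarith
qed


section \<open>Bounds in expectation\<close>

lemma solution_at_grid_times:
  assumes "ereal T < existence_time s P N \<xi> \<sigma> \<epsilon> dt dx v0 u" and "real M * dt \<le> T"
  shows "solution_up_to s P N \<xi> \<sigma> \<epsilon> dt dx v0 u M"
proof (rule ccontr)
  assume "\<not> ?thesis"
  then have "existence_time s P N \<xi> \<sigma> \<epsilon> dt dx v0 u \<le> ereal (real M * dt)"
    unfolding existence_time_def by (intro Inf_lower) blast
  also have "\<dots> \<le> ereal T" using assms(2) by simp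
  finally show False using assms(1) by simp
qed

text \<open>The equations hold almost surely for each of finitely many space-time points, hence almost surely
  at all of them at once, as summing over the grid requires.\<close>

lemma solution_mass_balance:
  assumes sol: "solution_up_to s P N \<xi> \<sigma> \<epsilon> dt dx v0 u M" and "dt > 0"
  shows "AE \<omega> in P. \<forall>k<M. discrete_mass dx N (\<lambda>j. u (k + 1) j \<omega>) - discrete_mass dx N (\<lambda>j. u k j \<omega>)
    = - (dt * dx * (\<Sum>j\<in>{0..int N}. \<epsilon> * scaled_noise dt dx (\<xi> k j \<omega>) * Im (u k j \<omega> + u (k + 1) j \<omega>)))"
proof -
  have "AE \<omega> in P. \<forall>k\<in>{..<M}. \<forall>j\<in>{0..int N}.
      scheme_equation s \<sigma> dt dx (\<epsilon> * scaled_noise dt dx (\<xi> k j \<omega>)) (\<lambda>k i. u k i \<omega>) k j"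
    using sol by (intro AE_finite_allI) (auto simp: solution_up_to_def)
  with AE_space show ?thesis
  proof eventually_elim
    case (elim \<omega>)
    show ?case
    proof (intro allI impI)
      fix k assume "k < M"
      then show "discrete_mass dx N (\<lambda>j. u (k + 1) j \<omega>) - discrete_mass dx N (\<lambda>j. u k j \<omega>)
        = - (dt * dx * (\<Sum>j\<in>{0..int N}. \<epsilon> * scaled_noise dt dx (\<xi> k j \<omega>) * Im (u k j \<omega> + u (k + 1) j \<omega>)))"
        using elim sol
        by (intro mass_balance[OF \<open>dt > 0\<close>, where v = "\<lambda>k i. u k i \<omega>" and s = s and \<sigma> = \<sigma>])
          (auto simp: solution_up_to_def)
    qed
  qed
qed

lemma measurable_discrete_mass:
  assumes "\<And>j. j \<in> {0..int N} \<Longrightarrow> f j \<in> borel_measurable P"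
  shows "(\<lambda>\<omega>. discrete_mass dx N (\<lambda>j. f j \<omega>)) \<in> borel_measurable P"
  unfolding discrete_mass_def using assms
  by (intro borel_measurable_times borel_measurable_sum borel_measurable_power
      borel_measurable_const measurable_compose[OF _ borel_measurable_norm]) auto

text \<open>The pathwise bound is linear in the noise energies, so it can be integrated term by term. It also
  supplies the integrability of the masses, which the mean-zero argument for a single time uses.\<close>

lemma expected_max_mass:
  assumes noise: "gaussian_noise P N \<xi>" and "dt > 0" "dx > 0" "\<alpha> > 0"
    and sol: "solution_up_to s P N \<xi> \<sigma> \<epsilon> dt dx v0 u M"
  shows "m \<le> M \<Longrightarrow> integrable P (\<lambda>\<omega>. discrete_mass dx N (\<lambda>j. u m j \<omega>))"
    and "integrable P (\<lambda>\<omega>. MAX m\<in>{0..M}. discrete_mass dx N (\<lambda>j. u m j \<omega>))"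
    and "(\<integral>\<omega>. (MAX m\<in>{0..M}. discrete_mass dx N (\<lambda>j. u m j \<omega>)) \<partial>P)
      \<le> (1 + \<alpha>) * discrete_mass dx N v0
        + (1 + 1 / \<alpha>) * (3 / 4) * \<epsilon>\<^sup>2 * real (N + 1) * real M * (real M * dt)"
proof -
  interpret prob_space P using gaussian_noiseD(1)[OF noise] .
  define g where "g = (\<lambda>k \<omega>. discrete_mass dx N (\<lambda>j. of_real (\<epsilon> * scaled_noise dt dx (\<xi> k j \<omega>))))"
  define S where "S \<omega> = (1 + \<alpha>) * discrete_mass dx N v0 + (1 + 1 / \<alpha>) * (real M * (\<Sum>k<M. dt\<^sup>2 * g k \<omega>))" for \<omega>
  have g: "integrable P (g k)" "(\<integral>\<omega>. g k \<omega> \<partial>P) = 3 / 4 * \<epsilon>\<^sup>2 * real (N + 1) / dt" for k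
    unfolding g_def using expectation_noise_energy[OF noise \<open>dt > 0\<close> \<open>dx > 0\<close>] by blast+
  have S: "integrable P S"
    unfolding S_def using g(1) by simp
  have bound: "AE \<omega> in P. \<forall>m\<le>M. discrete_mass dx N (\<lambda>j. u m j \<omega>) \<le> S \<omega>"
    using AE_space solution_mass_balance[OF sol \<open>dt > 0\<close>]
  proof eventually_elim
    case (elim \<omega>)
    have "discrete_mass dx N (\<lambda>j. u 0 j \<omega>) = discrete_mass dx N v0"
      using sol elim(1) by (simp add: discrete_mass_def solution_up_to_def)
    then show ?case
      using mass_le_noise_energy[OF \<open>\<alpha> > 0\<close> \<open>dt > 0\<close> \<open>dx > 0\<close>, of _ M N "\<lambda>k i. u k i \<omega>"
          "\<lambda>k j. \<epsilon> * scaled_noise dt dx (\<xi> k j \<omega>)"] elim(2)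
      by (simp add: S_def g_def)
  qed
  show int: "integrable P (\<lambda>\<omega>. discrete_mass dx N (\<lambda>j. u m j \<omega>))" if "m \<le> M" for m
  proof (rule Bochner_Integration.integrable_bound[OF S])
    show "(\<lambda>\<omega>. discrete_mass dx N (\<lambda>j. u m j \<omega>)) \<in> borel_measurable P"
    proof (rule measurable_discrete_mass)
      fix j assume "j \<in> {0..int N}"
      then have "u m j \<in> borel_measurable (noise_history P N \<xi> m)"
        using sol that by (simp add: solution_up_to_def)
      then show "u m j \<in> borel_measurable P"
        by (rule measurable_from_subalg[OF subalgebra_noise_history[OF noise]])
    qed
    show "AE \<omega> in P. norm (discrete_mass dx N (\<lambda>j. u m j \<omega>)) \<le> norm (S \<omega>)"
      using bound
    proof eventually_elim
      case (elim \<omega>)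
      then show ?case
        using that discrete_mass_nonneg[of dx N "\<lambda>j. u m j \<omega>"] \<open>dx > 0\<close> by force
    qed
  qed
  show int_max: "integrable P (\<lambda>\<omega>. MAX m\<in>{0..M}. discrete_mass dx N (\<lambda>j. u m j \<omega>))"
    by (intro integrable_MAX) (auto intro: int)
  have "(\<integral>\<omega>. (MAX m\<in>{0..M}. discrete_mass dx N (\<lambda>j. u m j \<omega>)) \<partial>P) \<le> (\<integral>\<omega>. S \<omega> \<partial>P)"
    using int_max S by (rule integral_mono_AE) (use bound in \<open>auto elim!: eventually_mono\<close>)
  also have "(\<integral>\<omega>. S \<omega> \<partial>P) = (1 + \<alpha>) * discrete_mass dx N v0
      + (1 + 1 / \<alpha>) * (real M * (\<Sum>k<M. dt\<^sup>2 * (3 / 4 * \<epsilon>\<^sup>2 * real (N + 1) / dt)))"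
    unfolding S_def using g by (simp add: prob_space)
  also have "\<dots> = (1 + \<alpha>) * discrete_mass dx N v0
        + (1 + 1 / \<alpha>) * (3 / 4) * \<epsilon>\<^sup>2 * real (N + 1) * real M * (real M * dt)"
    using \<open>dt > 0\<close> \<open>\<alpha> > 0\<close> by (simp add: field_simps power2_eq_square)
  finally show "(\<integral>\<omega>. (MAX m\<in>{0..M}. discrete_mass dx N (\<lambda>j. u m j \<omega>)) \<partial>P) \<le> \<dots>" .
qed

text \<open>The expectation of \<open>mass_step_implicit\<close>, in which the cross term of the old value with the noise
  drops out by independence.\<close>

lemma expected_mass_step:
  assumes noise: "gaussian_noise P N \<xi>" and "dt > 0" "dx > 0" "\<delta> > 0"
    and sol: "solution_up_to s P N \<xi> \<sigma> \<epsilon> dt dx v0 u M" and "k < M"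
  shows "(1 - \<delta> * dt) * (\<integral>\<omega>. discrete_mass dx N (\<lambda>j. u (k + 1) j \<omega>) \<partial>P)
    \<le> (\<integral>\<omega>. discrete_mass dx N (\<lambda>j. u k j \<omega>) \<partial>P) + 3 / (16 * \<delta>) * \<epsilon>\<^sup>2 * real (N + 1)"
proof -
  interpret prob_space P using gaussian_noiseD(1)[OF noise] .
  define g where "g = (\<lambda>\<omega>. discrete_mass dx N (\<lambda>j. of_real (\<epsilon> * scaled_noise dt dx (\<xi> k j \<omega>))))"
  define cross where "cross \<omega> = (\<Sum>j\<in>{0..int N}. \<epsilon> * scaled_noise dt dx (\<xi> k j \<omega>) * Im (u k j \<omega>))" for \<omega>
  have g: "integrable P g" "(\<integral>\<omega>. g \<omega> \<partial>P) = 3 / 4 * \<epsilon>\<^sup>2 * real (N + 1) / dt"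
    unfolding g_def using expectation_noise_energy[OF noise \<open>dt > 0\<close> \<open>dx > 0\<close>] by blast+
  \<comment> \<open>Integrability follows from the pathwise bound with any weight, for instance 1.\<close>
  note mass_int = expected_max_mass(1)[OF noise \<open>dt > 0\<close> \<open>dx > 0\<close> zero_less_one sol]
  have cross_eq: "cross \<omega> = (\<Sum>j\<in>{0..int N}.
      \<epsilon> * (sqrt 3 / 2 * (1 / (sqrt dt * sqrt dx))) * (Im (u k j \<omega>) * \<xi> k j \<omega>))" for \<omega>
    by (simp add: cross_def scaled_noise_def ac_simps)
  \<comment> \<open>The bound by the mass makes each factor \<open>Im (u k j)\<close> square integrable, hence integrable.\<close>
  have product: "integrable P (\<lambda>\<omega>. Im (u k j \<omega>) * \<xi> k j \<omega>)"
    "(\<integral>\<omega>. Im (u k j \<omega>) * \<xi> k j \<omega> \<partial>P) = 0" if j: "j \<in> {0..int N}" for j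
  proof -
    have adapted: "u k j \<in> borel_measurable (noise_history P N \<xi> k)"
      using sol j \<open>k < M\<close> by (simp add: solution_up_to_def)
    then have hist: "(\<lambda>\<omega>. Im (u k j \<omega>)) \<in> borel_measurable (noise_history P N \<xi> k)"
      by measurable
    have meas: "(\<lambda>\<omega>. Im (u k j \<omega>)) \<in> borel_measurable P"
      using measurable_from_subalg[OF subalgebra_noise_history[OF noise] hist] .
    have "integrable P (\<lambda>\<omega>. (Im (u k j \<omega>))\<^sup>2)"
    proof (rule Bochner_Integration.integrable_bound)
      show "integrable P (\<lambda>\<omega>. discrete_mass dx N (\<lambda>j. u k j \<omega>) / dx)"
        using mass_int[of k] \<open>k < M\<close> by simp
      show "(\<lambda>\<omega>. (Im (u k j \<omega>))\<^sup>2) \<in> borel_measurable P"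
        using meas by measurable
      have "(Im (u k j \<omega>))\<^sup>2 \<le> discrete_mass dx N (\<lambda>j. u k j \<omega>) / dx" for \<omega>
      proof -
        have "(Im (u k j \<omega>))\<^sup>2 \<le> (cmod (u k j \<omega>))\<^sup>2" by (simp add: cmod_power2)
        also have "\<dots> \<le> (\<Sum>j\<in>{0..int N}. (cmod (u k j \<omega>))\<^sup>2)"
          using j by (intro member_le_sum) auto
        finally show ?thesis using \<open>dx > 0\<close> by (simp add: discrete_mass_def)
      qed
      then show "AE \<omega> in P. norm ((Im (u k j \<omega>))\<^sup>2) \<le> norm (discrete_mass dx N (\<lambda>j. u k j \<omega>) / dx)"
        using \<open>dx > 0\<close> by (intro AE_I2) (simp add: discrete_mass_nonneg)
    qed
    with meas have "integrable P (\<lambda>\<omega>. Im (u k j \<omega>))"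
      by (rule square_integrable_imp_integrable)
    from expectation_adapted_times_noise[OF noise hist j this]
    show "integrable P (\<lambda>\<omega>. Im (u k j \<omega>) * \<xi> k j \<omega>)" "(\<integral>\<omega>. Im (u k j \<omega>) * \<xi> k j \<omega> \<partial>P) = 0" .
  qed
  have cross: "integrable P cross" "(\<integral>\<omega>. cross \<omega> \<partial>P) = 0"
    unfolding cross_eq using product
    by (auto simp: Bochner_Integration.integral_sum intro!: Bochner_Integration.integrable_sum sum.neutral)
  have masses: "integrable P (\<lambda>\<omega>. discrete_mass dx N (\<lambda>j. u (k + 1) j \<omega>))"
      "integrable P (\<lambda>\<omega>. discrete_mass dx N (\<lambda>j. u k j \<omega>))"
    using mass_int[of "k + 1"] mass_int[of k] \<open>k < M\<close> by auto
  have "(1 - \<delta> * dt) * (\<integral>\<omega>. discrete_mass dx N (\<lambda>j. u (k + 1) j \<omega>) \<partial>P)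
      = (\<integral>\<omega>. (1 - \<delta> * dt) * discrete_mass dx N (\<lambda>j. u (k + 1) j \<omega>) \<partial>P)"
    by simp
  also have "\<dots> \<le> (\<integral>\<omega>. discrete_mass dx N (\<lambda>j. u k j \<omega>) - dt * dx * cross \<omega> + dt / (4 * \<delta>) * g \<omega> \<partial>P)"
  proof (rule integral_mono_AE)
    show "AE \<omega> in P. (1 - \<delta> * dt) * discrete_mass dx N (\<lambda>j. u (k + 1) j \<omega>)
        \<le> discrete_mass dx N (\<lambda>j. u k j \<omega>) - dt * dx * cross \<omega> + dt / (4 * \<delta>) * g \<omega>"
      using solution_mass_balance[OF sol \<open>dt > 0\<close>]
    proof eventually_elim
      case (elim \<omega>)
      then show ?case
        using \<open>k < M\<close> unfolding cross_def g_def
        by (intro mass_step_implicit \<open>dt > 0\<close> \<open>dx > 0\<close> \<open>\<delta> > 0\<close>) blast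
    qed
  qed (use masses cross g in simp_all)
  also have "\<dots> = (\<integral>\<omega>. discrete_mass dx N (\<lambda>j. u k j \<omega>) \<partial>P) + dt / (4 * \<delta>) * (3 / 4 * \<epsilon>\<^sup>2 * real (N + 1) / dt)"
    using masses cross g by simp
  also have "dt / (4 * \<delta>) * (3 / 4 * \<epsilon>\<^sup>2 * real (N + 1) / dt) = 3 / (16 * \<delta>) * \<epsilon>\<^sup>2 * real (N + 1)"
    using \<open>dt > 0\<close> by simp
  finally show ?thesis .
qed

lemma expected_mass:
  assumes noise: "gaussian_noise P N \<xi>" and "dt > 0" "dx > 0" "\<delta> > 0" "\<delta> * dt \<le> 1 / 2"
    and sol: "solution_up_to s P N \<xi> \<sigma> \<epsilon> dt dx v0 u M"
  shows "(\<integral>\<omega>. discrete_mass dx N (\<lambda>j. u M j \<omega>) \<partial>P)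
    \<le> exp (2 * \<delta> * (real M * dt)) * (discrete_mass dx N v0 + real M * (3 / (16 * \<delta>) * \<epsilon>\<^sup>2 * real (N + 1)))"
proof -
  interpret prob_space P using gaussian_noiseD(1)[OF noise] .
  have initial: "(\<integral>\<omega>. discrete_mass dx N (\<lambda>j. u 0 j \<omega>) \<partial>P) = discrete_mass dx N v0"
  proof -
    have "(\<integral>\<omega>. discrete_mass dx N (\<lambda>j. u 0 j \<omega>) \<partial>P) = (\<integral>\<omega>. discrete_mass dx N v0 \<partial>P)"
      using sol by (intro Bochner_Integration.integral_cong)
        (auto simp: discrete_mass_def solution_up_to_def)
    then show ?thesis by (simp add: prob_space)
  qed
  show ?thesis
    using implicit_Gronwall[of "\<delta> * dt" "3 / (16 * \<delta>) * \<epsilon>\<^sup>2 * real (N + 1)"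
        "\<lambda>m. \<integral>\<omega>. discrete_mass dx N (\<lambda>j. u m j \<omega>) \<partial>P" M]
      expected_mass_step[OF noise \<open>dt > 0\<close> \<open>dx > 0\<close> \<open>\<delta> > 0\<close> sol] assms(2-5) initial
    by (simp add: discrete_mass_nonneg ac_simps)
qed

theorem proposition3p4:
  fixes P :: "'a measure" and s :: scheme
    and \<xi> :: "nat \<Rightarrow> int \<Rightarrow> 'a \<Rightarrow> real" and u :: "nat \<Rightarrow> int \<Rightarrow> 'a \<Rightarrow> complex"
    and u0 :: "real \<Rightarrow> complex" and x :: "int \<Rightarrow> real"
    and \<sigma> \<epsilon> Lc dt dx T \<alpha> :: real and N M :: nat
  assumes "\<sigma> > 0" and "\<epsilon> \<ge> 0" and "dt > 0"
    and "space_grid Lc N dx x"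
    and "gaussian_noise P N \<xi>"
    and "in_H1 u0" and "continuous_on UNIV u0"
    and "0 < T" and "ereal T < existence_time s P N \<xi> \<sigma> \<epsilon> dt dx (\<lambda>j. u0 (x j)) u"
    and "real M * dt \<le> T"
    and "\<alpha> > 0"
  shows "(dt \<le> T / (1 + \<alpha>) \<longrightarrow>
            integrable P (\<lambda>\<omega>. discrete_mass dx N (\<lambda>j. u M j \<omega>)) \<and>
            (\<integral>\<omega>. discrete_mass dx N (\<lambda>j. u M j \<omega>) \<partial>P)
              \<le> (1 + \<alpha>) * discrete_mass dx N (\<lambda>j. u0 (x j))
                + 3 * T * (1 + \<alpha>) / (4 * ln (1 + \<alpha>)) * \<epsilon>\<^sup>2 * (Lc / dx) * ((real M * dt) / dt))
       \<and> integrable P (\<lambda>\<omega>. MAX m\<in>{0..M}. discrete_mass dx N (\<lambda>j. u m j \<omega>))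
       \<and> (\<integral>\<omega>. (MAX m\<in>{0..M}. discrete_mass dx N (\<lambda>j. u m j \<omega>)) \<partial>P)
            \<le> (1 + \<alpha> + \<alpha> / (2 * T)) * discrete_mass dx N (\<lambda>j. u0 (x j))
              + 3 * T * (1 + \<alpha>)\<^sup>2 / (2 * \<alpha>) * \<epsilon>\<^sup>2 * (Lc / dx) * ((real M * dt) / dt)"
proof -
  let ?m0 = "discrete_mass dx N (\<lambda>j. u0 (x j))"
  have "dx > 0" and "real (N + 1) \<le> 2 * Lc / dx"
    using \<open>space_grid Lc N dx x\<close> by (auto simp: space_grid_def)
  then have points: "real (N + 1) \<le> 2 * (Lc / dx)" and "0 \<le> Lc / dx" and m0: "0 \<le> ?m0"
    by (simp_all add: discrete_mass_nonneg)
  have sol: "solution_up_to s P N \<xi> \<sigma> \<epsilon> dt dx (\<lambda>j. u0 (x j)) u M"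
    using solution_at_grid_times assms by blast
  note max = expected_max_mass[OF \<open>gaussian_noise P N \<xi>\<close> \<open>dt > 0\<close> \<open>dx > 0\<close> \<open>\<alpha> > 0\<close> sol]
  have "(\<integral>\<omega>. discrete_mass dx N (\<lambda>j. u M j \<omega>) \<partial>P) \<le> (1 + \<alpha>) * ?m0
      + 3 * T * (1 + \<alpha>) / (4 * ln (1 + \<alpha>)) * \<epsilon>\<^sup>2 * (Lc / dx) * ((real M * dt) / dt)"
    if dt: "dt \<le> T / (1 + \<alpha>)"
  proof -
    \<comment> \<open>Chosen so that \<open>exp (2 * \<delta> * T) = 1 + \<alpha>\<close>.\<close>
    define \<delta> where "\<delta> = ln (1 + \<alpha>) / (2 * T)"
    have ln: "ln (1 + \<alpha>) > 0" using \<open>\<alpha> > 0\<close> by simp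
    have "\<delta> > 0" using ln \<open>0 < T\<close> by (simp add: \<delta>_def)
    have "\<delta> * dt \<le> \<delta> * (T / (1 + \<alpha>))"
      using dt \<open>\<delta> > 0\<close> by (intro mult_left_mono) auto
    also have "\<dots> = ln (1 + \<alpha>) / (2 * (1 + \<alpha>))"
      using \<open>0 < T\<close> by (simp add: \<delta>_def)
    also have "\<dots> \<le> 1 / 2"
    proof -
      have "ln (1 + \<alpha>) \<le> 1 + \<alpha>" using \<open>\<alpha> > 0\<close> ln_bound[of "1 + \<alpha>"] by simp
      then show ?thesis using \<open>\<alpha> > 0\<close> by (simp add: divide_le_eq)
    qed
    finally have "\<delta> * dt \<le> 1 / 2" .
    have "2 * \<delta> * (real M * dt) \<le> 2 * \<delta> * T"
      using \<open>real M * dt \<le> T\<close> \<open>\<delta> > 0\<close> by simp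
    also have "\<dots> = ln (1 + \<alpha>)" using \<open>0 < T\<close> by (simp add: \<delta>_def)
    finally have growth: "exp (2 * \<delta> * (real M * dt)) \<le> 1 + \<alpha>"
      using \<open>\<alpha> > 0\<close> by (simp add: ln_ge_iff)
    have "(\<integral>\<omega>. discrete_mass dx N (\<lambda>j. u M j \<omega>) \<partial>P)
        \<le> exp (2 * \<delta> * (real M * dt)) * (?m0 + real M * (3 / (16 * \<delta>) * \<epsilon>\<^sup>2 * real (N + 1)))"
      using expected_mass[OF \<open>gaussian_noise P N \<xi>\<close> \<open>dt > 0\<close> \<open>dx > 0\<close> \<open>\<delta> > 0\<close> \<open>\<delta> * dt \<le> 1 / 2\<close> sol] .
    also have "\<dots> \<le> (1 + \<alpha>) * (?m0 + real M * (3 / (16 * \<delta>) * \<epsilon>\<^sup>2 * (2 * (Lc / dx))))"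
      using growth points m0 \<open>\<delta> > 0\<close> \<open>\<alpha> > 0\<close> by (intro mult_mono add_left_mono mult_left_mono) auto
    also have "\<dots> = (1 + \<alpha>) * ?m0
        + 3 * T * (1 + \<alpha>) / (4 * ln (1 + \<alpha>)) * \<epsilon>\<^sup>2 * (Lc / dx) * ((real M * dt) / dt)"
      using \<open>dt > 0\<close> \<open>0 < T\<close> ln \<open>dx > 0\<close> by (simp add: \<delta>_def field_simps)
    finally show ?thesis .
  qed
  moreover have "(\<integral>\<omega>. (MAX m\<in>{0..M}. discrete_mass dx N (\<lambda>j. u m j \<omega>)) \<partial>P)
      \<le> (1 + \<alpha> + \<alpha> / (2 * T)) * ?m0
        + 3 * T * (1 + \<alpha>)\<^sup>2 / (2 * \<alpha>) * \<epsilon>\<^sup>2 * (Lc / dx) * ((real M * dt) / dt)"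
  proof -
    have "(1 + 1 / \<alpha>) * (3 / 4) * \<epsilon>\<^sup>2 * real (N + 1) * real M * (real M * dt)
        \<le> (1 + 1 / \<alpha>) * (3 / 4) * \<epsilon>\<^sup>2 * (2 * (Lc / dx)) * real M * T"
      using points \<open>real M * dt \<le> T\<close> \<open>\<alpha> > 0\<close> \<open>dt > 0\<close> \<open>0 \<le> Lc / dx\<close>
      by (intro mult_mono mult_left_mono mult_right_mono mult_nonneg_nonneg) auto
    also have "\<dots> = 3 * T * (1 + \<alpha>) / (2 * \<alpha>) * \<epsilon>\<^sup>2 * (Lc / dx) * real M"
      using \<open>\<alpha> > 0\<close> \<open>dx > 0\<close> by (simp add: field_simps)
    also have "\<dots> \<le> 3 * T * (1 + \<alpha>)\<^sup>2 / (2 * \<alpha>) * \<epsilon>\<^sup>2 * (Lc / dx) * real M"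
      using \<open>\<alpha> > 0\<close> \<open>0 < T\<close> \<open>0 \<le> Lc / dx\<close> self_le_power[of "1 + \<alpha>" 2]
      by (intro mult_right_mono divide_right_mono mult_left_mono) auto
    finally have "(1 + 1 / \<alpha>) * (3 / 4) * \<epsilon>\<^sup>2 * real (N + 1) * real M * (real M * dt)
        \<le> 3 * T * (1 + \<alpha>)\<^sup>2 / (2 * \<alpha>) * \<epsilon>\<^sup>2 * (Lc / dx) * ((real M * dt) / dt)"
      using \<open>dt > 0\<close> by simp
    moreover have "(1 + \<alpha>) * ?m0 \<le> (1 + \<alpha> + \<alpha> / (2 * T)) * ?m0"
      using m0 \<open>\<alpha> > 0\<close> \<open>0 < T\<close> by (intro mult_right_mono) auto
    ultimately show ?thesis using max(3) by linarith
  qed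
  ultimately show ?thesis using max(1)[of M] max(2) by blast
qed

end
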